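(* Let $p\in\mathbb{R}\setminus\{0\}$, let $0<a<b$, and let $f:[a,b]\to\mathbb{R}$ be integrable on $[a,b]$. If $f$ is symmetrized $p$-convex on $[a,b]$, then $$f\left(\left[\frac{a^{p}+b^{p}}{2}\right]^{1/p}\right)\le \frac{p}{b^{p}-a^{p}}\int_{a}^{b}\frac{f(x)}{x^{1-p}}\,dx\le \frac{f(a)+f(b)}{2}.$$
   Context: Let $p\in\mathbb{R}\setminus\{0\}$. A function $h:I\to\mathbb{R}$ on a real interval $I\subseteq(0,\infty)$ is called $p$-convex if $h\left([tx^{p}+(1-t)y^{p}]^{1/p}\right)\le t\,h(x)+(1-t)\,h(y)$ for all $x,y\in I$ and $t\in[0,1]$. For $f:[a,b]\to\mathbb{R}$ with $[a,b]\subseteq(0,\infty)$, the $p$-symmetrical transform of $f$ on $[a,b]$ is the function $P_{(f;p)}(x)=\frac12\left[f(x)+f\left([a^{p}+b^{p}-x^{p}]^{1/p}\right)\right]$, $x\in[a,b]$. The function $f$ is called symmetrized $p$-convex on $[a,b]$ if $P_{(f;p)}$ is $p$-convex on $[a,b]$. *)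

theory Defs
  imports "HOL-Analysis.Analysis"
begin

text \<open>
  A function on an interval is represented by a total function on the reals; its values outside
  the interval are never used. On positive reals, real powers are given by \<open>powr\<close>. The parameter
  \<open>p\<close> is meant to be nonzero; for \<open>p = 0\<close> the exponent \<open>1 / p\<close> is meaningless.
\<close>

definition p_convex_on :: "real \<Rightarrow> real set \<Rightarrow> (real \<Rightarrow> real) \<Rightarrow> bool" where
  "p_convex_on p I h \<longleftrightarrow>
     is_interval I \<and> I \<subseteq> {0<..} \<and>
     (\<forall>x\<in>I. \<forall>y\<in>I. \<forall>t\<in>{0..1}.
        h ((t * x powr p + (1 - t) * y powr p) powr (1 / p)) \<le> t * h x + (1 - t) * h y)"

definition p_symmetrical_transform :: "real \<Rightarrow> real \<Rightarrow> real \<Rightarrow> (real \<Rightarrow> real) \<Rightarrow> real \<Rightarrow> real" where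
  "p_symmetrical_transform p a b f x =
     1 / 2 * (f x + f ((a powr p + b powr p - x powr p) powr (1 / p)))"

definition symmetrized_p_convex_on :: "real \<Rightarrow> real \<Rightarrow> real \<Rightarrow> (real \<Rightarrow> real) \<Rightarrow> bool" where
  "symmetrized_p_convex_on p a b f \<longleftrightarrow>
     p_convex_on p {a..b} (p_symmetrical_transform p a b f)"

end

theory Submission
  imports Defs
begin

text \<open>
  The reflection \<open>s\<close> of \<open>[a, b]\<close> with \<open>s x powr p = a powr p + b powr p - x powr p\<close> preserves the
  measure \<open>x powr (p - 1) dx\<close>, so \<open>f\<close> and its \<open>p\<close>-symmetrical transform \<open>P\<close> have the same integral
  against it. As \<open>P\<close> is invariant under \<open>s\<close> and the \<open>p\<close>-mean of \<open>x\<close> and \<open>s x\<close> is the fixed point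
  \<open>m\<close> of \<open>s\<close>, \<open>p\<close>-convexity gives \<open>f m = P m \<le> P x\<close>; writing \<open>x\<close> as a weighted \<open>p\<close>-mean of
  \<open>a\<close> and \<open>b\<close> gives \<open>P x \<le> P a = P b = (f a + f b) / 2\<close>. It remains to integrate these bounds.
\<close>

definition p_reflection :: "real \<Rightarrow> real \<Rightarrow> real \<Rightarrow> real \<Rightarrow> real" where
  "p_reflection p a b x = (a powr p + b powr p - x powr p) powr (1 / p)"

lemma p_symmetrical_transform_eq:
  "p_symmetrical_transform p a b f x = (f x + f (p_reflection p a b x)) / 2"
  by (simp add: p_symmetrical_transform_def p_reflection_def)

section \<open>Real powers and convex combinations of the endpoint powers\<close>

lemma powr_powr_inverse_exponent:
  fixes p u :: real
  assumes "p \<noteq> 0" "0 < u"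
  shows "(u powr (1 / p)) powr p = u" "(u powr p) powr (1 / p) = u"
  using assms by (simp_all add: powr_powr)

context
  fixes p a b :: real
  assumes p: "p \<noteq> 0" and a: "0 < a" and ab: "a < b"
begin

text \<open>The weight is the affine coordinate of \<open>x powr p\<close> between the endpoint
  powers. For negative \<open>p\<close> the order of the powers reverses, so numerator and
  denominator of \<open>t\<close> change sign together and \<open>t\<close> stays in
  \<open>[0, 1]\<close>.\<close>

lemma powr_interval_weight:
  assumes "x \<in> {a..b}"
  obtains t where "t \<in> {0..1}" "x powr p = t * a powr p + (1 - t) * b powr p"
proof -
  define d where "d = b powr p - a powr p"
  define t where "t = (b powr p - x powr p) / d"
  have "t \<in> {0..1} \<and> d \<noteq> 0"
  proof (cases "p > 0")
    case True
    then have "a powr p \<le> x powr p" "x powr p \<le> b powr p" "a powr p < b powr p"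
      using assms a ab by (auto intro: powr_mono2 powr_less_mono2)
    then show ?thesis by (auto simp: t_def d_def divide_simps)
  next
    case False
    then have "p < 0" using p by simp
    then have "x powr p \<le> a powr p" "b powr p \<le> x powr p" "b powr p < a powr p"
      using assms a ab by (auto intro: powr_mono2' powr_less_mono2_neg)
    then show ?thesis by (auto simp: t_def d_def divide_simps)
  qed
  moreover from this have "x powr p = b powr p - t * d"
    by (simp add: t_def)
  then have "x powr p = t * a powr p + (1 - t) * b powr p"
    by (simp add: d_def algebra_simps)
  ultimately show ?thesis using that by blast
qed

lemma powr_difference_quotient_pos: "0 < p / (b powr p - a powr p)"
proof (cases "p > 0")
  case True
  then show ?thesis using a ab by (simp add: powr_less_mono2)
next
  case False
  then have "p < 0" using p by simp
  moreover from this have "b powr p < a powr p"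
    using a ab by (intro powr_less_mono2_neg) auto
  ultimately show ?thesis by (simp add: divide_neg_neg)
qed

text \<open>The combination lies between the endpoint powers, and the exponent \<open>1 / p\<close>
  has the same sign as \<open>p\<close>: for negative \<open>p\<close> the two order reversals
  cancel.\<close>

lemma convex_combination_powr_mem:
  assumes "t \<in> {0..1}"
  shows "(t * a powr p + (1 - t) * b powr p) powr (1 / p) \<in> {a..b}"
proof -
  define A B where "A = a powr p" and "B = b powr p"
  define u where "u = t * A + (1 - t) * B"
  have pos: "0 < A" "0 < B" using a ab by (auto simp: A_def B_def)
  have inv: "A powr (1 / p) = a" "B powr (1 / p) = b"
    using a ab p by (auto simp: A_def B_def powr_powr)
  have eq: "u - A = (1 - t) * (B - A)" "B - u = t * (B - A)"
    by (auto simp: u_def algebra_simps)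
  have "u powr (1 / p) \<in> {a..b}"
  proof (cases "p > 0")
    case True
    then have "A \<le> B" using a ab by (auto simp: A_def B_def intro: powr_mono2)
    then have "0 \<le> u - A" "0 \<le> B - u" using assms unfolding eq by auto
    then have "A powr (1 / p) \<le> u powr (1 / p)" "u powr (1 / p) \<le> B powr (1 / p)"
      using True pos by (auto intro!: powr_mono2)
    then show ?thesis by (simp add: inv)
  next
    case False
    then have neg: "p < 0" using p by simp
    then have "B \<le> A" using a ab by (auto simp: A_def B_def intro: powr_mono2')
    then have "u - A \<le> 0" "B - u \<le> 0"
      using assms unfolding eq by (auto simp: mult_nonneg_nonpos)
    then have "A powr (1 / p) \<le> u powr (1 / p)" "u powr (1 / p) \<le> B powr (1 / p)"
      using neg pos by (auto intro!: powr_mono2')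
    then show ?thesis by (simp add: inv)
  qed
  then show ?thesis by (simp add: u_def A_def B_def)
qed

section \<open>The reflection as a differentiable involution of the interval\<close>

lemma p_reflection_mem:
  assumes "x \<in> {a..b}"
  shows "p_reflection p a b x \<in> {a..b}"
proof -
  obtain t where t: "t \<in> {0..1}" "x powr p = t * a powr p + (1 - t) * b powr p"
    using powr_interval_weight[OF assms] .
  \<comment> \<open>In the coordinate \<open>t\<close>, reflection swaps the weights of the two
    endpoints.\<close>
  then have "a powr p + b powr p - x powr p = (1 - t) * a powr p + (1 - (1 - t)) * b powr p"
    by (simp add: algebra_simps)
  then show ?thesis
    unfolding p_reflection_def using convex_combination_powr_mem[of "1 - t"] t(1) by simp
qed

lemma reflected_powr_pos:
  assumes "x \<in> {a..b}"
  shows "0 < a powr p + b powr p - x powr p"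
proof -
  have "0 < p_reflection p a b x"
    using p_reflection_mem[OF assms] a by auto
  \<comment> \<open>Since \<open>0 powr (1 / p) = 0\<close>, a vanishing base would force the
    reflection to be \<open>0\<close>.\<close>
  then have "a powr p + b powr p - x powr p \<noteq> 0"
    by (auto simp: p_reflection_def)
  moreover have "0 \<le> a powr p + b powr p - x powr p"
  proof -
    obtain t where t: "t \<in> {0..1}" "x powr p = t * a powr p + (1 - t) * b powr p"
      using powr_interval_weight[OF assms] .
    then have "a powr p + b powr p - x powr p = (1 - t) * a powr p + t * b powr p"
      by (simp add: algebra_simps)
    then show ?thesis using t(1) by simp
  qed
  ultimately show ?thesis by simp
qed

lemma p_reflection_powr:
  assumes "x \<in> {a..b}"
  shows "p_reflection p a b x powr p = a powr p + b powr p - x powr p"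
  unfolding p_reflection_def
  using powr_powr_inverse_exponent(1)[OF p reflected_powr_pos[OF assms]] .

lemma p_reflection_involution:
  assumes "x \<in> {a..b}"
  shows "p_reflection p a b (p_reflection p a b x) = x"
proof -
  have "p_reflection p a b (p_reflection p a b x) = (x powr p) powr (1 / p)"
    by (subst p_reflection_def) (simp add: p_reflection_powr[OF assms])
  then show ?thesis using powr_powr_inverse_exponent(2)[of p x] p assms a by simp
qed

lemma p_reflection_image: "p_reflection p a b ` {a..b} = {a..b}"
proof
  show "{a..b} \<subseteq> p_reflection p a b ` {a..b}"
    by (metis image_eqI p_reflection_involution p_reflection_mem subsetI)
qed (use p_reflection_mem in blast)

lemma inj_on_p_reflection: "inj_on (p_reflection p a b) {a..b}"
  by (rule inj_on_inverseI) (rule p_reflection_involution)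

text \<open>This is implicit differentiation of \<open>s x powr p + x powr p = const\<close>.
  Writing the derivative through \<open>s x\<close> itself lets its first factor cancel the
  transported weight in the change of variables.\<close>

lemma p_reflection_deriv:
  assumes "x \<in> {a..b}"
  shows "(p_reflection p a b has_field_derivative
           - (p_reflection p a b x powr (1 - p) * x powr (p - 1))) (at x within {a..b})"
proof -
  let ?u = "a powr p + b powr p - x powr p"
  have x: "0 < x" and u: "0 < ?u"
    using assms a reflected_powr_pos by auto
  have "((\<lambda>x. (a powr p + b powr p - x powr p) powr (1 / p)) has_field_derivative
      (1 / p) * ?u powr (1 / p - 1) * (- (p * x powr (p - 1)))) (at x)"
    using x u p by (auto intro!: derivative_eq_intros)
  moreover have "?u powr (1 / p - 1) = p_reflection p a b x powr (1 - p)"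
    using p by (simp add: p_reflection_def powr_powr diff_divide_distrib algebra_simps)
  ultimately show ?thesis
    using p by (auto simp: p_reflection_def[abs_def] intro: has_field_derivative_at_within)
qed

section \<open>Integrals against the weight \<open>x powr (p - 1)\<close>\<close>

lemma weighted_absolutely_integrable:
  assumes "f absolutely_integrable_on {a..b}"
  shows "(\<lambda>x. x powr (p - 1) * f x) absolutely_integrable_on {a..b}"
proof (rule absolutely_integrable_bounded_measurable_product_real)
  \<comment> \<open>As \<open>0 < a\<close>, the weight is continuous on a compact interval, hence a
    bounded measurable factor.\<close>
  have cont: "continuous_on {a..b} (\<lambda>x. x powr (p - 1))"
    using a by (intro continuous_intros) auto
  show "(\<lambda>x. x powr (p - 1)) \<in> borel_measurable (lebesgue_on {a..b})"
    by (rule continuous_imp_measurable_on_sets_lebesgue[OF cont]) simp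
  show "bounded ((\<lambda>x. x powr (p - 1)) ` {a..b})"
    by (intro compact_imp_bounded compact_continuous_image cont compact_Icc)
qed (use assms in auto)

lemma has_integral_powr_weight:
  "((\<lambda>x. x powr (p - 1)) has_integral (b powr p - a powr p) / p) {a..b}"
proof -
  have "((\<lambda>x. x powr (p - 1)) has_integral (b powr p / p - a powr p / p)) {a..b}"
    using a ab p
    by (intro fundamental_theorem_of_calculus)
       (auto intro!: derivative_eq_intros simp flip: has_real_derivative_iff_has_vector_derivative)
  then show ?thesis by (simp add: diff_divide_distrib)
qed

text \<open>Substitution along the injective map \<open>s\<close> of \<open>[a, b]\<close> onto
  itself. The absolute value of the Jacobian absorbs the reversal of orientation, and its product
  with \<open>s x powr (p - 1)\<close> is \<open>x powr (p - 1)\<close>.\<close>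

lemma weighted_integral_p_reflection:
  fixes f :: "real \<Rightarrow> real"
  assumes "f absolutely_integrable_on {a..b}"
  defines "I \<equiv> integral {a..b} (\<lambda>x. x powr (p - 1) * f x)"
  shows "((\<lambda>x. x powr (p - 1) * f (p_reflection p a b x)) has_integral I) {a..b}"
proof -
  let ?s = "p_reflection p a b"
  let ?F = "\<lambda>x. \<bar>- (?s x powr (1 - p) * x powr (p - 1))\<bar> * (?s x powr (p - 1) * f (?s x))"
  have "?F absolutely_integrable_on {a..b} \<and> integral {a..b} ?F = I"
    using has_absolute_integral_change_of_variables_1'
        [of "{a..b}" ?s "\<lambda>x. - (?s x powr (1 - p) * x powr (p - 1))"
          "\<lambda>x. x powr (p - 1) * f x" I]
      p_reflection_deriv inj_on_p_reflection weighted_absolutely_integrable[OF assms(1)]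
    by (simp add: p_reflection_image I_def)
  then have "(?F has_integral I) {a..b}"
    using set_lebesgue_integral_eq_integral(1)
    by (blast intro: has_integral_integrable_integral[THEN iffD2])
  moreover have "?F x = x powr (p - 1) * f (?s x)" if "x \<in> {a..b}" for x
  proof -
    have "?s x powr (1 - p) * ?s x powr (p - 1) = 1"
      using p_reflection_mem[OF that] a by (simp flip: powr_add)
    then show ?thesis by (simp add: abs_mult mult_ac)
  qed
  ultimately show ?thesis by (rule has_integral_cong[THEN iffD1, rotated])
qed

lemma weighted_integral_p_symmetrical_transform:
  fixes f :: "real \<Rightarrow> real"
  assumes "f absolutely_integrable_on {a..b}"
  shows "((\<lambda>x. x powr (p - 1) * p_symmetrical_transform p a b f x) has_integral
           integral {a..b} (\<lambda>x. x powr (p - 1) * f x)) {a..b}"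
proof -
  let ?I = "integral {a..b} (\<lambda>x. x powr (p - 1) * f x)"
  have "((\<lambda>x. x powr (p - 1) * f x) has_integral ?I) {a..b}"
    by (intro integrable_integral set_lebesgue_integral_eq_integral(1)
        weighted_absolutely_integrable assms)
  from has_integral_divide[OF has_integral_add[OF this weighted_integral_p_reflection[OF assms]], of 2]
  show ?thesis by (simp add: p_symmetrical_transform_eq algebra_simps add_divide_distrib)
qed

section \<open>Pointwise bounds for the symmetrical transform\<close>

lemma p_symmetrical_transform_bounds:
  assumes f: "symmetrized_p_convex_on p a b f" and x: "x \<in> {a..b}"
  shows "f (((a powr p + b powr p) / 2) powr (1 / p)) \<le> p_symmetrical_transform p a b f x"
    and "p_symmetrical_transform p a b f x \<le> (f a + f b) / 2"
proof -
  let ?P = "p_symmetrical_transform p a b f" and ?s = "p_reflection p a b"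
  have conv: "?P ((t * x powr p + (1 - t) * y powr p) powr (1 / p)) \<le> t * ?P x + (1 - t) * ?P y"
    if "x \<in> {a..b}" "y \<in> {a..b}" "t \<in> {0..1}" for x y t
    using f that unfolding symmetrized_p_convex_on_def p_convex_on_def by blast
  define M where "M = (a powr p + b powr p) / 2"
  define m where "m = M powr (1 / p)"
  have "0 < M" using a ab by (simp add: M_def add_pos_pos)
  then have "m powr p = M" using powr_powr_inverse_exponent(1) p m_def by simp
  moreover have "a powr p + b powr p = M + M" by (simp add: M_def)
  ultimately have "?s m = m" by (simp add: p_reflection_def m_def)
  then have "f m = ?P m" by (simp add: p_symmetrical_transform_eq)
  \<comment> \<open>The powers of \<open>x\<close> and \<open>?s x\<close> add up to
    \<open>2 * M\<close>, so their \<open>p\<close>-mean with equal weights is \<open>m\<close>,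
    whatever \<open>x\<close> is.\<close>
  also have "\<dots> \<le> 1 / 2 * ?P x + (1 - 1 / 2) * ?P (?s x)"
    using conv[OF x p_reflection_mem[OF x], of "1 / 2"]
    by (simp add: p_reflection_powr[OF x] m_def M_def field_simps)
  also have "\<dots> = ?P x"
    by (simp add: p_symmetrical_transform_eq p_reflection_involution[OF x] field_simps)
  finally show "f (((a powr p + b powr p) / 2) powr (1 / p)) \<le> ?P x"
    by (simp add: m_def M_def)
  obtain t where t: "t \<in> {0..1}" "x powr p = t * a powr p + (1 - t) * b powr p"
    using powr_interval_weight[OF x] .
  have "?s a = b" "?s b = a"
    using powr_powr_inverse_exponent(2) p a ab by (auto simp: p_reflection_def)
  then have ends: "?P a = (f a + f b) / 2" "?P b = (f a + f b) / 2"
    by (auto simp: p_symmetrical_transform_eq)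
  \<comment> \<open>This form exposes \<open>x\<close> as the \<open>p\<close>-mean of
    \<open>a\<close> and \<open>b\<close> with weight \<open>t\<close>, ready for convexity.\<close>
  have "?P x = ?P ((x powr p) powr (1 / p))"
    using powr_powr_inverse_exponent(2)[of p x] p a x by simp
  also have "\<dots> \<le> t * ?P a + (1 - t) * ?P b"
    unfolding t(2) using conv[of a b t] t(1) ab by simp
  also have "\<dots> = (f a + f b) / 2"
    unfolding ends by (simp flip: distrib_right)
  finally show "?P x \<le> (f a + f b) / 2" .
qed

end

theorem theorem11:
  fixes p a b :: real and f :: "real \<Rightarrow> real"
  assumes "p \<noteq> 0"
    and "0 < a" and "a < b"
    and "set_integrable lebesgue {a..b} f"
    and "symmetrized_p_convex_on p a b f"
  shows "f (((a powr p + b powr p) / 2) powr (1 / p))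
           \<le> p / (b powr p - a powr p) * (LINT x:{a..b}|lebesgue. f x / x powr (1 - p))
       \<and> p / (b powr p - a powr p) * (LINT x:{a..b}|lebesgue. f x / x powr (1 - p))
           \<le> (f a + f b) / 2"
proof -
  let ?P = "p_symmetrical_transform p a b f"
  let ?m = "((a powr p + b powr p) / 2) powr (1 / p)"
  \<comment> \<open>\<open>W\<close> is the total mass of the weight on \<open>[a, b]\<close>,
    positive for either sign of \<open>p\<close>; the middle term of the claim is thus the weighted
    mean \<open>I / W\<close>.\<close>
  define W where "W = (b powr p - a powr p) / p"
  define I where "I = integral {a..b} (\<lambda>x. x powr (p - 1) * f x)"
  note ctx = assms(1-3)
  have "f x / x powr (1 - p) = x powr (p - 1) * f x" for x
    using powr_minus_divide[of x "1 - p"] by simp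
  \<comment> \<open>Absolute integrability identifies the Lebesgue integral with the gauge integral
    \<open>I\<close>.\<close>
  then have LINT: "(LINT x:{a..b}|lebesgue. f x / x powr (1 - p)) = I"
    using set_lebesgue_integral_eq_integral(2)[OF weighted_absolutely_integrable[OF ctx assms(4)]]
    by (simp add: I_def)
  have W: "((\<lambda>x. x powr (p - 1) * c) has_integral W * c) {a..b}" for c
    unfolding W_def by (intro has_integral_mult_left has_integral_powr_weight ctx)
  have P: "((\<lambda>x. x powr (p - 1) * ?P x) has_integral I) {a..b}"
    unfolding I_def by (intro weighted_integral_p_symmetrical_transform ctx assms(4))
  \<comment> \<open>The pointwise bounds by constants are integrated against the nonnegative weight;
    division by \<open>W\<close> comes last.\<close>
  have "W * f ?m \<le> I"
    by (rule has_integral_le[OF W P])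
       (simp add: mult_left_mono p_symmetrical_transform_bounds(1)[OF ctx assms(5)])
  moreover have "I \<le> W * ((f a + f b) / 2)"
    by (rule has_integral_le[OF P W], rule mult_left_mono)
       (use p_symmetrical_transform_bounds(2)[OF ctx assms(5)] in auto)
  moreover have W_pos: "0 < W"
    using powr_difference_quotient_pos[OF ctx] by (auto simp: W_def zero_less_divide_iff)
  moreover have quotient: "p / (b powr p - a powr p) * I = I / W"
    by (simp add: W_def)
  ultimately show ?thesis
    unfolding LINT quotient pos_le_divide_eq[OF W_pos] pos_divide_le_eq[OF W_pos]
    by (simp add: mult.commute)
qed

end
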